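(* Let $n$ range over even positive integers such that $n/2$ is odd, and let $\tau_{\mathrm{mix}}=\tau_{\mathrm{mix}}(n)$ be the mixing time of the generalized Rudvalis shuffle on $n$ cards with $p_n = p_{n/2} = 1/2$. Then $\tau_{\mathrm{mix}} = \Omega(n^2)$ as $n\to\infty$.
   Context: Generalized Rudvalis (GR) shuffle: the state space is the set $S_n$ of orderings of a deck of $n$ cards, with positions $1$ (top) to $n$ (bottom), and each position $j$ has a fixed probability $p_j$, $\sum_j p_j=1$. At each time step, independently of the past, a position is chosen, position $j$ with probability $p_j$, and the card currently in that position is moved to the top of the deck without altering the relative order of the other cards. Here $p_{n/2}=p_n=1/2$ and all other $p_j$ are $0$. The stationary distribution is the uniform distribution on $S_n$. Mixing time: with $\|\mu-\nu\|=\frac12\sum_s|\mu(s)-\nu(s)|$ and $\nu_{\mathrm{st}}$ the stationary distribution, $\tau_{\mathrm{mix}} := \max_s\min\{t : \|P(X_t\in\cdot\mid X_0=s)-\nu_{\mathrm{st}}\|\leq 1/4\}$. *)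

theory Defs
  imports "HOL-Probability.Probability" "HOL-Combinatorics.Multiset_Permutations"
begin

section \<open>Mixing times of finite Markov chains\<close>

text \<open>A chain is given by its transition kernel \<open>K\<close>: from the state \<open>x\<close>, the next state has
  distribution \<open>K x\<close>. The law of \<open>X\<^sub>t\<close> given \<open>X\<^sub>0 = s\<close> is the following.\<close>

definition law_after :: "('a \<Rightarrow> 'a pmf) \<Rightarrow> nat \<Rightarrow> 'a \<Rightarrow> 'a pmf" where
  "law_after K t s = ((\<lambda>\<mu>. bind_pmf \<mu> K) ^^ t) (return_pmf s)"

definition tv_dist :: "'a set \<Rightarrow> 'a pmf \<Rightarrow> 'a pmf \<Rightarrow> real" where
  "tv_dist S \<mu> \<nu> = (\<Sum>s\<in>S. \<bar>pmf \<mu> s - pmf \<nu> s\<bar>) / 2"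

text \<open>The infimum of a nonempty set of times is its minimum; if the distance never drops to
  \<open>1/4\<close>, the infimum of the empty set is \<open>\<infinity>\<close>, the usual convention.\<close>

definition mixing_time :: "'a set \<Rightarrow> ('a \<Rightarrow> 'a pmf) \<Rightarrow> 'a pmf \<Rightarrow> enat" where
  "mixing_time S K \<nu> =
     (MAX s\<in>S. INF t\<in>{t. tv_dist S (law_after K t s) \<nu> \<le> 1/4}. enat t)"

section \<open>The generalized Rudvalis shuffle\<close>

text \<open>A deck is the list of its cards from top to bottom, so position \<open>j\<close> (counted from 1) is
  the list index \<open>j - 1\<close>.\<close>

definition decks :: "nat \<Rightarrow> nat list set" where
  "decks n = permutations_of_set {1..n}"

definition move_to_top :: "nat \<Rightarrow> 'a list \<Rightarrow> 'a list" where
  "move_to_top j xs = xs ! (j - 1) # take (j - 1) xs @ drop j xs"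

definition GR_shuffle :: "nat pmf \<Rightarrow> 'a list \<Rightarrow> 'a list pmf" where
  "GR_shuffle p xs = map_pmf (\<lambda>j. move_to_top j xs) p"

text \<open>The uniform distribution on \<open>decks n\<close> is the stationary distribution.\<close>

definition GR_mixing_time :: "nat \<Rightarrow> nat pmf \<Rightarrow> enat" where
  "GR_mixing_time n p = mixing_time (decks n) (GR_shuffle p) (pmf_of_set (decks n))"

text \<open>\<open>p\<^sub>n = p\<^sub>n\<^sub>/\<^sub>2 = 1/2\<close>, for even \<open>n > 0\<close>.\<close>

definition half_full_pmf :: "nat \<Rightarrow> nat pmf" where
  "half_full_pmf n = pmf_of_set {n div 2, n}"

end

theory Submission
  imports Defs
begin

text \<open>
  Even the position of a single card needs order \<open>n\<^sup>2\<close> steps to forget where it started. Write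
  \<open>n = 2 * m\<close>. A card in the top half moves down one place at every step, except that from
  position \<open>m\<close> it goes to position \<open>1\<close> or to position \<open>m + 1\<close> with equal probability. A card in
  the bottom half moves one place with probability \<open>1/2\<close>, from position \<open>n\<close> to position \<open>1\<close>, and
  rests otherwise. Give each position a phase that turns by the angle \<open>\<omega> = 2 * pi / m\<close> per place in
  the top half and by \<open>2 * \<omega>\<close> per place in the bottom half, so that the mean rotation speed is \<open>\<omega>\<close>
  everywhere. The top half then makes one full turn and the bottom half two, so the two positions
  that may follow \<open>m\<close> carry the same phase, and positions \<open>n\<close> and \<open>1\<close> fit together as well.

  One step multiplies the phase by exactly \<open>cis \<omega>\<close> in the top half. In the bottom half it
  multiplies it on average by \<open>(1 + cis (2 * \<omega>)) / 2 = cos \<omega> * cis \<omega>\<close>, which differs from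
  \<open>cis \<omega>\<close> only by \<open>1 - cos \<omega> \<le> \<omega>\<^sup>2 / 2\<close>. The phase is thus an approximate eigenfunction with
  eigenvalue of modulus \<open>1\<close>, and its mean after \<open>t\<close> steps has modulus at least
  \<open>1 - t * \<omega>\<^sup>2 / 2\<close>. Under the uniform distribution the mean phase is \<open>0\<close>, so a total variation
  distance of at most \<open>1/4\<close> forces \<open>1 - t * \<omega>\<^sup>2 / 2 \<le> 1/2\<close>, that is
  \<open>t \<ge> 1 / \<omega>\<^sup>2 = n\<^sup>2 / (16 * pi\<^sup>2)\<close>.
\<close>

section \<open>Mixing times and approximate eigenfunctions\<close>

lemma law_after_0 [simp]: "law_after K 0 s = return_pmf s"
  by (simp add: law_after_def)

lemma law_after_Suc [simp]: "law_after K (Suc t) s = bind_pmf (law_after K t s) K"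
  by (simp add: law_after_def)

lemma set_law_after_subset:
  assumes "s \<in> S" "\<And>x. x \<in> S \<Longrightarrow> set_pmf (K x) \<subseteq> S"
  shows "set_pmf (law_after K t s) \<subseteq> S"
  using assms by (induction t) auto

lemma norm_expectation_le:
  fixes f :: "'a \<Rightarrow> 'b :: {banach, second_countable_topology}"
  assumes "finite S" "set_pmf \<mu> \<subseteq> S" "\<And>x. x \<in> S \<Longrightarrow> norm (f x) \<le> B"
  shows "norm (measure_pmf.expectation \<mu> f) \<le> B"
proof -
  have "norm (measure_pmf.expectation \<mu> f) = norm (\<Sum>x\<in>S. pmf \<mu> x *\<^sub>R f x)"
    using assms by (subst integral_measure_pmf[of S]) auto
  also have "\<dots> \<le> (\<Sum>x\<in>S. pmf \<mu> x * B)"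
    by (rule sum_norm_le) (use assms in \<open>auto intro!: mult_left_mono\<close>)
  also have "\<dots> = B"
    using sum_pmf_eq_1[of S \<mu>] assms by (simp flip: sum_distrib_right)
  finally show ?thesis .
qed

lemma norm_expectation_diff_le_tv_dist:
  fixes f :: "'a \<Rightarrow> 'b :: {banach, second_countable_topology}"
  assumes "finite S" "set_pmf \<mu> \<subseteq> S" "set_pmf \<nu> \<subseteq> S" "\<And>x. x \<in> S \<Longrightarrow> norm (f x) \<le> 1"
  shows "norm (measure_pmf.expectation \<mu> f - measure_pmf.expectation \<nu> f)
           \<le> 2 * tv_dist S \<mu> \<nu>"
proof -
  have eq: "measure_pmf.expectation \<rho> f = (\<Sum>x\<in>S. pmf \<rho> x *\<^sub>R f x)"
    if "set_pmf \<rho> \<subseteq> S" for \<rho>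
    using assms(1) that by (subst integral_measure_pmf[of S]) auto
  have "norm (measure_pmf.expectation \<mu> f - measure_pmf.expectation \<nu> f) =
        norm (\<Sum>x\<in>S. (pmf \<mu> x - pmf \<nu> x) *\<^sub>R f x)"
    using assms by (simp add: eq sum_subtractf scaleR_diff_left)
  also have "\<dots> \<le> (\<Sum>x\<in>S. \<bar>pmf \<mu> x - pmf \<nu> x\<bar>)"
    by (rule sum_norm_le) (use assms(4) in \<open>auto intro!: mult_left_le\<close>)
  finally show ?thesis
    by (simp add: tv_dist_def)
qed

text \<open>A kernel is a contraction in the supremum norm, and \<open>\<zeta>\<close> has modulus \<open>1\<close>, so the error
  \<open>\<epsilon>\<close> made in each step is not amplified later: the errors only add up.\<close>

lemma approx_eigenfunction_drift:
  fixes f :: "'a \<Rightarrow> complex"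
  assumes S: "finite S" "s \<in> S" "\<And>x. x \<in> S \<Longrightarrow> set_pmf (K x) \<subseteq> S"
    and \<zeta>: "norm \<zeta> = 1"
    and eig: "\<And>x. x \<in> S \<Longrightarrow> norm (measure_pmf.expectation (K x) f - \<zeta> * f x) \<le> \<epsilon>"
  shows "norm (measure_pmf.expectation (law_after K t s) f - \<zeta> ^ t * f s) \<le> real t * \<epsilon>"
proof (induction t)
  case (Suc t)
  let ?\<mu> = "law_after K t s" and ?E = "measure_pmf.expectation"
  have supp: "set_pmf ?\<mu> \<subseteq> S"
    using S by (intro set_law_after_subset) auto
  have int: "integrable (measure_pmf ?\<mu>) g" for g :: "'a \<Rightarrow> complex"
    using supp S(1) by (intro integrable_measure_pmf_finite) (auto dest: finite_subset)
  have "?E (law_after K (Suc t) s) f = ?E ?\<mu> (\<lambda>x. ?E (K x) f)"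
    using S supp finite_subset[OF S(3) S(1)]
    by (simp add: pmf_expectation_bind[of S] integral_measure_pmf[of S] subset_iff)
  then have "?E (law_after K (Suc t) s) f - \<zeta> ^ Suc t * f s =
      ?E ?\<mu> (\<lambda>x. ?E (K x) f - \<zeta> * f x) + \<zeta> * (?E ?\<mu> f - \<zeta> ^ t * f s)"
    by (simp add: int Bochner_Integration.integral_diff algebra_simps)
  also have "norm \<dots> \<le> \<epsilon> + real t * \<epsilon>"
  proof (intro norm_triangle_mono)
    show "norm (?E ?\<mu> (\<lambda>x. ?E (K x) f - \<zeta> * f x)) \<le> \<epsilon>"
      using S(1) supp eig by (rule norm_expectation_le)
    show "norm (\<zeta> * (?E ?\<mu> f - \<zeta> ^ t * f s)) \<le> real t * \<epsilon>"
      using Suc.IH by (simp add: norm_mult \<zeta>)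
  qed
  finally show ?case
    by (simp add: algebra_simps)
qed simp

lemma expectation_pmf_of_set:
  fixes f :: "'a \<Rightarrow> 'b :: {banach, second_countable_topology}"
  assumes "finite A" "A \<noteq> {}"
  shows "measure_pmf.expectation (pmf_of_set A) f = sum f A /\<^sub>R card A"
  using assms by (subst integral_measure_pmf[of A]) (auto simp: scaleR_sum_right divide_inverse)

lemma mixing_time_ge:
  assumes "finite S" "s \<in> S"
    and "\<And>t. tv_dist S (law_after K t s) \<nu> \<le> 1/4 \<Longrightarrow> T \<le> t"
  shows "enat T \<le> mixing_time S K \<nu>"
proof -
  have "enat T \<le> (INF t\<in>{t. tv_dist S (law_after K t s) \<nu> \<le> 1/4}. enat t)"
    using assms(3) by (auto intro!: INF_greatest)
  also have "\<dots> \<le> mixing_time S K \<nu>"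
    unfolding mixing_time_def using assms(1,2) by (intro Max_ge) auto
  finally show ?thesis .
qed

section \<open>The motion of a single card\<close>

definition card_pos :: "'a \<Rightarrow> 'a list \<Rightarrow> nat" where
  "card_pos a xs = (THE i. i < length xs \<and> xs ! i = a)"

lemma card_pos_eqI:
  assumes "distinct xs" "i < length xs" "xs ! i = a"
  shows "card_pos a xs = i"
  unfolding card_pos_def using assms by (auto intro!: the_equality simp: nth_eq_iff_index_eq)

lemma mset_move_to_top:
  assumes "1 \<le> k" "k \<le> length xs"
  shows "mset (move_to_top k xs) = mset xs"
proof -
  have "xs = take (k - 1) xs @ xs ! (k - 1) # drop k xs"
    using id_take_nth_drop[of "k - 1" xs] assms by simp
  then have "mset xs = mset (take (k - 1) xs @ xs ! (k - 1) # drop k xs)"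
    by simp
  then show ?thesis
    by (simp add: move_to_top_def)
qed

lemma move_to_top_nth:
  assumes "1 \<le> k" "k \<le> length xs" "i < length xs"
  shows "move_to_top k xs ! (if i < k then Suc i mod k else i) = xs ! i"
proof -
  consider "i < k - 1" | "i = k - 1" | "k \<le> i"
    using assms by linarith
  then show ?thesis
    using assms by cases (auto simp: move_to_top_def nth_append nth_Cons split: nat.split)
qed

lemma decks_iff: "xs \<in> decks n \<longleftrightarrow> set xs = {1..n} \<and> distinct xs"
  by (auto simp: decks_def permutations_of_set_def)

lemma finite_decks [simp]: "finite (decks n)"
  by (simp add: decks_def)

lemma decks_nonempty [simp]: "decks n \<noteq> {}"
  by (simp add: decks_def)

lemma length_deck: "xs \<in> decks n \<Longrightarrow> length xs = n"
  by (auto simp: decks_iff dest: distinct_card)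

lemma move_to_top_deck:
  assumes "xs \<in> decks n" "1 \<le> k" "k \<le> n"
  shows "move_to_top k xs \<in> decks n"
proof -
  have "mset (move_to_top k xs) = mset xs"
    using assms by (intro mset_move_to_top) (auto simp: length_deck)
  then show ?thesis
    using assms(1) by (metis decks_iff mset_eq_imp_distinct_iff mset_eq_setD)
qed

lemma deck_card_pos:
  assumes "xs \<in> decks n" "a \<in> {1..n}"
  shows "card_pos a xs < n" "xs ! card_pos a xs = a"
proof -
  obtain i where "i < length xs" "xs ! i = a"
    using assms by (metis decks_iff in_set_conv_nth)
  then show "card_pos a xs < n" "xs ! card_pos a xs = a"
    using assms by (auto simp: decks_iff card_pos_eqI length_deck)
qed

lemma card_pos_move_to_top:
  assumes "xs \<in> decks n" "a \<in> {1..n}" "1 \<le> k" "k \<le> n"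
  shows "card_pos a (move_to_top k xs) =
    (if card_pos a xs < k then Suc (card_pos a xs) mod k else card_pos a xs)"
proof (rule card_pos_eqI)
  have len: "length xs = n" "length (move_to_top k xs) = n"
    using assms by (auto simp: length_deck move_to_top_deck)
  note pos = deck_card_pos[OF assms(1,2)]
  show "distinct (move_to_top k xs)"
    using move_to_top_deck[OF assms(1,3,4)] by (simp add: decks_iff)
  have "Suc (card_pos a xs) mod k < k"
    using assms by simp
  then show "(if card_pos a xs < k then Suc (card_pos a xs) mod k else card_pos a xs)
      < length (move_to_top k xs)"
    using len pos(1) assms(4) by (auto intro: less_le_trans)
  show "move_to_top k xs ! (if card_pos a xs < k then Suc (card_pos a xs) mod k
      else card_pos a xs) = a"
    using move_to_top_nth[of k xs "card_pos a xs"] pos len assms by simp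
qed

text \<open>Rotating the deck shows that all positions of a card are equally likely in a uniformly
  random deck.\<close>

lemma card_decks_with_card_at:
  assumes "i < n"
  shows "card {xs \<in> decks n. xs ! i = a} = card {xs \<in> decks n. xs ! 0 = a}"
  using assms
proof (induction i)
  case (Suc i)
  let ?A = "\<lambda>i. {xs \<in> decks n. xs ! i = a}"
  have onto: "rotate1 ` decks n = decks n"
    by (rule endo_inj_surj) (auto simp: decks_iff inj_on_subset[OF inj_rotate1])
  have shift: "rotate1 xs ! i = xs ! Suc i" if "xs \<in> decks n" for xs
    using that Suc.prems by (simp add: nth_rotate1 length_deck)
  have "rotate1 ` ?A (Suc i) = {ys \<in> rotate1 ` decks n. ys ! i = a}"
    by (auto simp: shift)
  then have "rotate1 ` ?A (Suc i) = ?A i"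
    unfolding onto .
  then have "card (?A (Suc i)) = card (?A i)"
    using card_image[OF inj_on_subset[OF inj_rotate1 subset_UNIV], of "?A (Suc i)"] by simp
  with Suc show ?case by simp
qed simp

lemma sum_card_pos_decks:
  fixes g :: "nat \<Rightarrow> 'b :: comm_semiring_1"
  assumes "a \<in> {1..n}"
  shows "(\<Sum>xs\<in>decks n. g (card_pos a xs)) =
    of_nat (card {xs \<in> decks n. xs ! 0 = a}) * (\<Sum>i<n. g i)"
proof -
  have fibre: "{xs \<in> decks n. card_pos a xs = i} = {xs \<in> decks n. xs ! i = a}" if "i < n" for i
    using that deck_card_pos[OF _ assms] by (auto simp: decks_iff length_deck intro!: card_pos_eqI)
  have "(\<Sum>xs\<in>decks n. g (card_pos a xs)) =
      (\<Sum>i<n. \<Sum>xs | xs \<in> decks n \<and> card_pos a xs = i. g (card_pos a xs))"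
    using deck_card_pos[OF _ assms] by (intro sum.group[symmetric]) auto
  also have "\<dots> = (\<Sum>i<n. of_nat (card {xs \<in> decks n. xs ! 0 = a}) * g i)"
  proof (intro sum.cong refl)
    fix i assume "i \<in> {..<n}"
    then have i: "i < n" by simp
    have "(\<Sum>xs | xs \<in> decks n \<and> card_pos a xs = i. g (card_pos a xs)) =
        of_nat (card {xs \<in> decks n. card_pos a xs = i}) * g i"
      by simp
    then show "(\<Sum>xs | xs \<in> decks n \<and> card_pos a xs = i. g (card_pos a xs)) =
        of_nat (card {xs \<in> decks n. xs ! 0 = a}) * g i"
      by (simp only: fibre[OF i] card_decks_with_card_at[OF i])
  qed
  finally show ?thesis
    by (simp add: sum_distrib_left)
qed

section \<open>The phase of a position\<close>

text \<open>Positions are list indices here, so the bottom half starts at \<open>i = m\<close>, and the exponent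
  \<open>2 * i - m\<close> is \<open>m + 2 * (i - m)\<close>. In the bottom half the expected speed of a card is \<open>1/2\<close>,
  which the doubled angle makes up for.\<close>

definition phase :: "nat \<Rightarrow> nat \<Rightarrow> complex" where
  "phase m i = cis (2 * pi / m) ^ (if i < m then i else 2 * i - m)"

lemma norm_phase [simp]: "norm (phase m i) = 1"
  by (simp add: phase_def norm_power)

lemma cis_root_power: "0 < m \<Longrightarrow> cis (2 * pi / m) ^ m = 1"
  by (simp only: Complex.DeMoivre) simp

text \<open>For a card at the end of the top half the two moves lead to different positions, one below
  it and one at the top of the deck. Since the top half is one full turn, the phase is the same.\<close>

lemma phase_top_step:
  assumes "i < m"
  shows "phase m (Suc i) = cis (2 * pi / m) * phase m i"
    and "phase m (Suc i mod m) = cis (2 * pi / m) * phase m i"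
proof -
  have m: "cis (2 * pi / m) * cis (2 * pi / m) ^ (m - 1) = 1"
    using cis_root_power[of m] assms by (simp flip: power_Suc)
  consider "Suc i < m" | "i = m - 1" "Suc i = m"
    using assms by linarith
  note c = this
  show "phase m (Suc i) = cis (2 * pi / m) * phase m i"
    using c by cases (use assms m cis_root_power[of m] in \<open>auto simp: phase_def\<close>)
  show "phase m (Suc i mod m) = cis (2 * pi / m) * phase m i"
    using c by cases (use assms m in \<open>auto simp: phase_def\<close>)
qed

lemma phase_bottom_step:
  assumes "m \<le> i" "i < 2 * m"
  shows "phase m (Suc i mod (2 * m)) = cis (2 * pi / m) ^ 2 * phase m i"
proof (cases "Suc i = 2 * m")
  case True
  then have "2 + (2 * i - m) = 3 * m"
    using assms by linarith
  then have "cis (2 * pi / m) ^ 2 * phase m i = (cis (2 * pi / m) ^ m) ^ 3"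
    using assms by (simp add: phase_def mult.commute flip: power_add power_mult)
  then show ?thesis
    using True assms cis_root_power[of m] by (simp add: phase_def)
next
  case False
  then have "Suc i mod (2 * m) = Suc i" "2 * Suc i - m = 2 + (2 * i - m)"
    using assms by auto
  then show ?thesis
    using assms by (simp add: phase_def power2_eq_square)
qed

lemma norm_half_step_error: "norm ((1 + cis w ^ 2) / 2 - cis w) \<le> w\<^sup>2 / 2"
proof -
  have "(1 + cis w ^ 2) / 2 = of_real (cos w) * cis w"
  proof -
    have "2 * of_real (cos w) = cis w + cis (- w)"
      by (simp add: complex_eq_iff)
    moreover have "cis (- w) * cis w = 1"
      by (simp add: cis_mult)
    ultimately show ?thesis
      by (simp add: field_simps power2_eq_square)
  qed
  then have "norm ((1 + cis w ^ 2) / 2 - cis w) = norm (of_real (cos w - 1) * cis w)"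
    by (simp add: algebra_simps)
  also have "\<dots> = 1 - cos w"
    by (simp only: norm_mult norm_cis norm_of_real) simp
  also have "\<dots> = 2 * (sin (w / 2))\<^sup>2"
    using cos_double_sin[of "w / 2"] by simp
  also have "\<dots> \<le> 2 * (w / 2)\<^sup>2"
    using abs_sin_x_le_abs_x[of "w / 2"] by (simp only: abs_le_square_iff mult_left_mono)
  finally show ?thesis
    by (simp add: power2_eq_square)
qed

text \<open>Each half contributes a geometric sum of \<open>m\<close> powers of an \<open>m\<close>-th root of unity, which
  vanishes unless the root is \<open>1\<close>. For the bottom half the root is the square of
  \<open>cis (2 * pi / m)\<close>, which is why \<open>m\<close> has to exceed \<open>2\<close>.\<close>

lemma sum_phase_eq_0:
  assumes "3 \<le> m"
  shows "(\<Sum>i<2 * m. phase m i) = 0"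
proof -
  define z where "z = cis (2 * pi / m)"
  have zm: "z ^ m = 1"
    using assms by (simp add: z_def cis_root_power)
  have z2: "z ^ 2 \<noteq> 1"
  proof
    assume "z ^ 2 = 1"
    then have "cis (real 2 * (2 * pi / m)) = 1"
      by (simp only: z_def Complex.DeMoivre)
    then have "cos (2 * (2 * pi / m)) = 1"
      by (simp add: complex_eq_iff)
    then obtain k :: int where "2 * (2 * pi / m) = real_of_int k * 2 * pi"
      unfolding cos_one_2pi_int by blast
    then have "real_of_int 2 = real_of_int (k * int m)"
      using assms by (simp add: field_simps)
    then have "2 = k * int m"
      by (simp only: of_int_eq_iff)
    then have "int m dvd 2"
      by (metis dvd_triv_right)
    then show False
      using assms zdvd_imp_le by fastforce
  qed
  then have z1: "z \<noteq> 1"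
    by auto
  have geo: "(\<Sum>i<m. q ^ i) = 0" if "q ^ m = 1" "q \<noteq> 1" for q :: complex
    using that by (simp add: geometric_sum)
  have "(\<Sum>i<2 * m. phase m i) = (\<Sum>i=0..<m. phase m i) + (\<Sum>i=m..<2 * m. phase m i)"
    unfolding lessThan_atLeast0 by (rule sum.atLeastLessThan_concat[symmetric]) auto
  also have "(\<Sum>i=m..<2 * m. phase m i) = (\<Sum>i<m. phase m (m + i))"
    using sum.shift_bounds_nat_ivl[of "phase m" 0 m m]
    by (simp add: mult_2 add.commute lessThan_atLeast0)
  also have "(\<Sum>i=0..<m. phase m i) = (\<Sum>i<m. z ^ i)"
    by (simp add: phase_def z_def lessThan_atLeast0)
  also have "(\<Sum>i<m. phase m (m + i)) = (\<Sum>i<m. (z ^ 2) ^ i)"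
    using zm by (intro sum.cong) (auto simp: phase_def power_add simp flip: z_def power_mult)
  also have "(\<Sum>i<m. z ^ i) + (\<Sum>i<m. (z ^ 2) ^ i) = 0"
  proof -
    have "(z ^ 2) ^ m = 1"
      using zm by (metis power_commutes power_mult power_one mult.commute)
    then show ?thesis
      using geo[OF zm z1] geo[of "z ^ 2"] z2 by simp
  qed
  finally show ?thesis .
qed

section \<open>The half-full shuffle\<close>

lemma expectation_GR_half_full:
  fixes f :: "nat list \<Rightarrow> complex"
  assumes "0 < m"
  shows "measure_pmf.expectation (GR_shuffle (half_full_pmf (2 * m)) xs) f =
    (f (move_to_top m xs) + f (move_to_top (2 * m) xs)) / 2"
  using assms
  by (simp add: GR_shuffle_def half_full_pmf_def expectation_pmf_of_set scaleR_conv_of_real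
      field_simps)

lemma set_GR_half_full_subset:
  assumes "0 < m" "xs \<in> decks (2 * m)"
  shows "set_pmf (GR_shuffle (half_full_pmf (2 * m)) xs) \<subseteq> decks (2 * m)"
  using assms by (auto simp: GR_shuffle_def half_full_pmf_def intro!: move_to_top_deck)

text \<open>The eigenfunction equation is exact while the card is in the top half; the whole error
  comes from the randomly delayed motion in the bottom half.\<close>

lemma phase_approx_eigenfunction:
  assumes "0 < m" "xs \<in> decks (2 * m)" "a \<in> {1..2 * m}"
  defines "f \<equiv> \<lambda>xs. phase m (card_pos a xs)"
  shows "norm (measure_pmf.expectation (GR_shuffle (half_full_pmf (2 * m)) xs) f
    - cis (2 * pi / m) * f xs) \<le> (2 * pi / m)\<^sup>2 / 2"
proof -
  let ?z = "cis (2 * pi / m)"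
  define i where "i = card_pos a xs"
  have i: "i < 2 * m"
    unfolding i_def using assms by (intro deck_card_pos(1))
  have step: "f (move_to_top k xs) = phase m (if i < k then Suc i mod k else i)"
    if "1 \<le> k" "k \<le> 2 * m" for k
    using that assms by (simp add: f_def i_def card_pos_move_to_top)
  have E: "measure_pmf.expectation (GR_shuffle (half_full_pmf (2 * m)) xs) f =
      (phase m (if i < m then Suc i mod m else i) + phase m (Suc i mod (2 * m))) / 2"
    using assms(1) i by (simp add: expectation_GR_half_full step)
  show ?thesis
  proof (cases "i < m")
    case True
    then have "Suc i mod (2 * m) = Suc i"
      by simp
    then show ?thesis
      using True unfolding E by (simp add: phase_top_step f_def i_def)
  next
    case False
    then have next_phase: "phase m (Suc i mod (2 * m)) = ?z ^ 2 * phase m i"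
      using i by (intro phase_bottom_step) auto
    have "(phase m i + phase m (Suc i mod (2 * m))) / 2 - ?z * phase m i
        = ((1 + ?z ^ 2) / 2 - ?z) * phase m i"
      unfolding next_phase by (simp add: field_simps)
    then show ?thesis
      using False norm_half_step_error[of "2 * pi / m"] unfolding E
      by (simp add: norm_mult f_def flip: i_def)
  qed
qed

text \<open>The modulus of the phase is \<open>1\<close> on every deck, so the bound holds from every start \<open>s\<close>,
  and a maximiser of the eigenfunction need not be found.\<close>

lemma half_full_mixing_lower_bound:
  assumes m: "3 \<le> m" and s: "s \<in> decks (2 * m)"
    and tv: "tv_dist (decks (2 * m)) (law_after (GR_shuffle (half_full_pmf (2 * m))) t s)
      (pmf_of_set (decks (2 * m))) \<le> 1/4"
  shows "(real m)\<^sup>2 / (4 * pi\<^sup>2) \<le> real t"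
proof -
  let ?D = "decks (2 * m)" and ?K = "GR_shuffle (half_full_pmf (2 * m))"
    and ?E = "measure_pmf.expectation"
  define f where "f = (\<lambda>xs :: nat list. phase m (card_pos 1 xs))"
  define w where "w = 2 * pi / m"
  have K: "set_pmf (?K xs) \<subseteq> ?D" if "xs \<in> ?D" for xs
    using that m by (intro set_GR_half_full_subset) auto
  have "?E (pmf_of_set ?D) f = 0"
    using m sum_card_pos_decks[of 1 "2 * m" "phase m"]
    by (simp add: expectation_pmf_of_set f_def sum_phase_eq_0)
  then have "norm (?E (law_after ?K t s) f) \<le> 2 * tv_dist ?D (law_after ?K t s) (pmf_of_set ?D)"
    using norm_expectation_diff_le_tv_dist[of ?D "law_after ?K t s" "pmf_of_set ?D" f]
      set_law_after_subset[of s ?D ?K t] s K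
    by (simp add: f_def)
  then have small: "norm (?E (law_after ?K t s) f) \<le> 1/2"
    using tv by simp
  have "norm (?E (law_after ?K t s) f - cis w ^ t * f s) \<le> real t * (w\<^sup>2 / 2)"
    using s K m unfolding f_def w_def
    by (intro approx_eigenfunction_drift[of ?D] phase_approx_eigenfunction) auto
  moreover have "norm (cis w ^ t * f s) = 1"
    by (simp add: norm_mult norm_power f_def)
  ultimately have "1 - real t * (w\<^sup>2 / 2) \<le> norm (?E (law_after ?K t s) f)"
    using norm_triangle_sub[of "cis w ^ t * f s" "?E (law_after ?K t s) f"]
    by (simp add: norm_minus_commute)
  with small have "1 \<le> real t * w\<^sup>2"
    by simp
  then show ?thesis
    using m by (simp add: w_def field_simps power_mult_distrib power_divide)
qed

theorem theorem4p6:
  "\<exists>c::real. c > 0 \<and>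
     (\<forall>\<^sub>F n :: nat in sequentially. even n \<and> odd (n div 2) \<longrightarrow>
        ereal (c * (real n)\<^sup>2) \<le> ereal_of_enat (GR_mixing_time n (half_full_pmf n)))"
proof (intro exI[of _ "1 / (16 * pi\<^sup>2)"] conjI eventually_sequentiallyI[of 6] impI)
  fix n :: nat
  assume n: "6 \<le> n" "even n \<and> odd (n div 2)"
  then obtain m where m: "n = 2 * m" "3 \<le> m"
    by auto
  obtain s where s: "s \<in> decks n"
    using decks_nonempty by blast
  define T where "T = nat \<lceil>(real m)\<^sup>2 / (4 * pi\<^sup>2)\<rceil>"
  have "enat T \<le> GR_mixing_time n (half_full_pmf n)"
    unfolding GR_mixing_time_def
  proof (rule mixing_time_ge[OF finite_decks s])
    fix t
    assume "tv_dist (decks n) (law_after (GR_shuffle (half_full_pmf n)) t s)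
      (pmf_of_set (decks n)) \<le> 1/4"
    then have "(real m)\<^sup>2 / (4 * pi\<^sup>2) \<le> real t"
      using half_full_mixing_lower_bound[OF m(2)] s unfolding m(1) by blast
    then show "T \<le> t"
      by (simp add: T_def nat_le_iff ceiling_le_iff)
  qed
  then have "ereal (real T) \<le> ereal_of_enat (GR_mixing_time n (half_full_pmf n))"
    by (metis ereal_of_enat_le_iff ereal_of_enat_simps(1))
  moreover have "1 / (16 * pi\<^sup>2) * (real n)\<^sup>2 \<le> real T"
    unfolding T_def m(1) by (simp add: power_mult_distrib)
  ultimately show "ereal (1 / (16 * pi\<^sup>2) * (real n)\<^sup>2)
      \<le> ereal_of_enat (GR_mixing_time n (half_full_pmf n))"
    by (meson ereal_less_eq(3) order_trans)
qed simp

end
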